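(* With respect to the group $G_2$ (and up to multiplication by nonzero constants), there are infinitely many orbits for the complex conic sections $p\in\mathbb{C}[z_1,z_2]$, with the following representatives, grouped by the arrangement of the roots of the initial form of $p$ in $\mathbb{P}^1$: (1a) (a double real root): (1a.1) $p=z_1^2+\gamma$, or (1a.2) $p=z_1^2+\gamma z_2$; (1b) (two distinct real roots): $p=z_1z_2+\gamma$; (2a) (a double non-real root): (2a.1) $p=(z_1-\mathrm{i}z_2)^2+\gamma$, or (2a.2) $p=(z_1-\mathrm{i}z_2)^2+\gamma z_2$; (2b) (one real and one non-real root): $p=z_2(z_1-\alpha z_2)+\gamma$; (2c) (two distinct non-real roots): (2c.1) $p=z_1^2+z_2^2+\gamma$, or (2c.2) $p=(z_1-\mathrm{i}z_2)(z_1-\alpha z_2)+\gamma$; for some $\gamma,\alpha\in\mathbb{C}$ such that, to avoid overlapping, $\gamma\neq0$ in (1a.2) and (2a.2), $\alpha\notin\mathbb{R}$ in (2b) and (2c.2), and $\alpha\neq\pm\mathrm{i}$ in (2c.2).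
   Context: A complex conic is a polynomial $p=az_1^2+bz_1z_2+cz_2^2+dz_1+ez_2+f$ with $a,\dots,f\in\mathbb{C}$ of total degree exactly two. Its initial form is $az_1^2+bz_1z_2+cz_2^2$, which has two roots $(z_1:z_2)$ in the complex projective line $\mathbb{P}^1$ (with multiplicity); a root is real if it lies in $\mathbb{P}^1_{\mathbb{R}}$. $G_2=\mathbb{C}^2\rtimes\mathrm{GL}_2(\mathbb{R})$ is the group generated by real invertible linear transformations and complex translations of $(z_1,z_2)$, acting on polynomials by substitution. Conics differing by a nonzero constant factor define the same conic section. *)

theory Defs
  imports "HOL-Analysis.Analysis" "HOL-Computational_Algebra.Polynomial_Factorial"
    "HOL-Computational_Algebra.Field_as_Ring"
begin

(* The ring C[z1, z2] is rendered as complex poly poly, that is C[z1][z2]: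
   z2 is the outer variable and z1 the inner one. *)

type_synonym cpoly2 = "complex poly poly"

definition Cst :: "complex \<Rightarrow> cpoly2" where
  "Cst c = [:[:c:]:]"

definition Z1 :: cpoly2 where
  "Z1 = [:[:0, 1:]:]"

definition Z2 :: cpoly2 where
  "Z2 = [:0, 1:]"

(* the coefficient of z1 ^ i * z2 ^ j *)
definition coeff2 :: "cpoly2 \<Rightarrow> nat \<Rightarrow> nat \<Rightarrow> complex" where
  "coeff2 p i j = coeff (coeff p j) i"

(* the zero polynomial gets total degree 0 *)
definition total_degree :: "cpoly2 \<Rightarrow> nat" where
  "total_degree p = Max (insert 0 {i + j | i j. coeff2 p i j \<noteq> 0})"

definition conics :: "cpoly2 set" where
  "conics = {p. total_degree p = 2}"

definition initial_form :: "cpoly2 \<Rightarrow> cpoly2" where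
  "initial_form p =
     Cst (coeff2 p 2 0) * Z1\<^sup>2 + Cst (coeff2 p 1 1) * Z1 * Z2 + Cst (coeff2 p 0 2) * Z2\<^sup>2"


(* subst2 p P Q = p(P, Q) *)
definition subst2 :: "cpoly2 \<Rightarrow> cpoly2 \<Rightarrow> cpoly2 \<Rightarrow> cpoly2" where
  "subst2 p P Q = poly (map_poly (\<lambda>r. poly (map_poly Cst r) P) p) Q"

(* A pair (A, b) stands for the map z \<mapsto> A z + b on C^2. *)
definition G2 :: "((real^2^2) \<times> (complex^2)) set" where
  "G2 = {(A, b). invertible A}"

fun G2_act :: "(real^2^2) \<times> (complex^2) \<Rightarrow> cpoly2 \<Rightarrow> cpoly2" where
  "G2_act (A, b) p = subst2 p
     (Cst (of_real (A$1$1)) * Z1 + Cst (of_real (A$1$2)) * Z2 + Cst (b$1))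
     (Cst (of_real (A$2$1)) * Z1 + Cst (of_real (A$2$2)) * Z2 + Cst (b$2))"

(* Same G2-orbit up to a nonzero constant factor; the classes in conics // G2_equiv are the
   orbits of complex conic sections. *)
definition G2_equiv :: "(cpoly2 \<times> cpoly2) set" where
  "G2_equiv = {(p, q). p \<in> conics \<and> q \<in> conics \<and>
     (\<exists>g\<in>G2. \<exists>c. c \<noteq> 0 \<and> q = Cst c * G2_act g p)}"


definition proportional :: "complex^2 \<Rightarrow> complex^2 \<Rightarrow> bool" where
  "proportional v w \<longleftrightarrow> v \<noteq> 0 \<and> w \<noteq> 0 \<and> (\<exists>c. c \<noteq> 0 \<and> w = c *s v)"

lemma part_equivp_proportional: "part_equivp proportional"
proof (rule part_equivpI)
  show "\<exists>v. proportional v v"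
    by (rule exI[of _ 1]) (auto simp: proportional_def intro!: exI[of _ 1])
  show "symp proportional"
  proof (rule sympI)
    fix v w assume "proportional v w"
    then obtain c where "v \<noteq> 0" "w \<noteq> 0" "c \<noteq> 0" "w = c *s v"
      by (auto simp: proportional_def)
    then show "proportional w v"
      by (auto simp: proportional_def vector_smult_assoc intro!: exI[of _ "inverse c"])
  qed
  show "transp proportional"
  proof (rule transpI)
    fix u v w assume "proportional u v" "proportional v w"
    then obtain c d where "u \<noteq> 0" "w \<noteq> 0" "c \<noteq> 0" "d \<noteq> 0" "v = c *s u" "w = d *s v"
      by (auto simp: proportional_def)
    then show "proportional u w"
      by (auto simp: proportional_def vector_smult_assoc intro!: exI[of _ "d * c"])
  qed
qed

quotient_type cproj1 = "complex^2" / partial: proportional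
  by (rule part_equivp_proportional)

lift_definition real_point :: "cproj1 \<Rightarrow> bool" is
  "\<lambda>w. \<exists>c. c \<noteq> 0 \<and> c * w$1 \<in> \<real> \<and> c * w$2 \<in> \<real>"
proof -
  have aux: "\<exists>c. c \<noteq> 0 \<and> c * w$1 \<in> \<real> \<and> c * w$2 \<in> \<real>"
    if "proportional v w" "\<exists>c. c \<noteq> 0 \<and> c * v$1 \<in> \<real> \<and> c * v$2 \<in> \<real>" for v w
  proof -
    from that obtain c d where "c \<noteq> 0" "w = c *s v" "d \<noteq> 0" "d * v$1 \<in> \<real>" "d * v$2 \<in> \<real>"
      by (auto simp: proportional_def)
    then show ?thesis by (intro exI[of _ "d / c"]) auto
  qed
  fix v w assume *: "proportional v w"
  then have "proportional w v"
    using part_equivp_proportional by (blast dest: part_equivp_symp)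
  with * show "(\<exists>c. c \<noteq> 0 \<and> c * v$1 \<in> \<real> \<and> c * v$2 \<in> \<real>)
      = (\<exists>c. c \<noteq> 0 \<and> c * w$1 \<in> \<real> \<and> c * w$2 \<in> \<real>)"
    using aux by blast
qed

lemma Cst_mult: "Cst (a * b) = Cst a * Cst b"
  by (simp add: Cst_def)

lemma is_unit_Cst: "c \<noteq> 0 \<Longrightarrow> is_unit (Cst c)"
  by (rule dvdI[of _ _ "Cst (inverse c)"]) (simp add: Cst_def one_pCons)

(* The multiplicity of the point (w1 : w2) as a root of a binary form q is the multiplicity of
   the linear form w2 z1 - w1 z2 in q. *)
lift_definition root_order :: "cpoly2 \<Rightarrow> cproj1 \<Rightarrow> nat" is
  "\<lambda>q w. multiplicity (Cst (w$2) * Z1 - Cst (w$1) * Z2) q"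
proof -
  fix q v w assume "proportional v w"
  then obtain c where c: "c \<noteq> 0" "w = c *s v"
    by (auto simp: proportional_def)
  have "Cst (w$2) * Z1 - Cst (w$1) * Z2 = Cst c * (Cst (v$2) * Z1 - Cst (v$1) * Z2)"
    using c by (simp add: Cst_mult algebra_simps)
  then show "multiplicity (Cst (v$2) * Z1 - Cst (v$1) * Z2) q
      = multiplicity (Cst (w$2) * Z1 - Cst (w$1) * Z2) q"
    using is_unit_Cst[OF c(1)] by (simp add: multiplicity_times_unit_left)
qed


datatype root_arrangement =
  Double_Real | Two_Real | Double_Nonreal | Real_Nonreal | Two_Nonreal

fun has_arrangement :: "cpoly2 \<Rightarrow> root_arrangement \<Rightarrow> bool" where
  "has_arrangement q Double_Real \<longleftrightarrow> (\<exists>P. real_point P \<and> root_order q P = 2)"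
| "has_arrangement q Two_Real \<longleftrightarrow>
     (\<exists>P Q. P \<noteq> Q \<and> real_point P \<and> real_point Q \<and> root_order q P = 1 \<and> root_order q Q = 1)"
| "has_arrangement q Double_Nonreal \<longleftrightarrow> (\<exists>P. \<not> real_point P \<and> root_order q P = 2)"
| "has_arrangement q Real_Nonreal \<longleftrightarrow>
     (\<exists>P Q. real_point P \<and> \<not> real_point Q \<and> root_order q P = 1 \<and> root_order q Q = 1)"
| "has_arrangement q Two_Nonreal \<longleftrightarrow>
     (\<exists>P Q. P \<noteq> Q \<and> \<not> real_point P \<and> \<not> real_point Q \<and> root_order q P = 1 \<and> root_order q Q = 1)"

datatype conic_family =
  Fam_1a1 | Fam_1a2 | Fam_1b | Fam_2a1 | Fam_2a2 | Fam_2b | Fam_2c1 | Fam_2c2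

fun family_arrangement :: "conic_family \<Rightarrow> root_arrangement" where
  "family_arrangement Fam_1a1 = Double_Real"
| "family_arrangement Fam_1a2 = Double_Real"
| "family_arrangement Fam_1b = Two_Real"
| "family_arrangement Fam_2a1 = Double_Nonreal"
| "family_arrangement Fam_2a2 = Double_Nonreal"
| "family_arrangement Fam_2b = Real_Nonreal"
| "family_arrangement Fam_2c1 = Two_Nonreal"
| "family_arrangement Fam_2c2 = Two_Nonreal"

fun representatives :: "conic_family \<Rightarrow> cpoly2 set" where
  "representatives Fam_1a1 = {Z1\<^sup>2 + Cst \<gamma> | \<gamma>. True}"
| "representatives Fam_1a2 = {Z1\<^sup>2 + Cst \<gamma> * Z2 | \<gamma>. \<gamma> \<noteq> 0}"
| "representatives Fam_1b = {Z1 * Z2 + Cst \<gamma> | \<gamma>. True}"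
| "representatives Fam_2a1 = {(Z1 - Cst \<i> * Z2)\<^sup>2 + Cst \<gamma> | \<gamma>. True}"
| "representatives Fam_2a2 = {(Z1 - Cst \<i> * Z2)\<^sup>2 + Cst \<gamma> * Z2 | \<gamma>. \<gamma> \<noteq> 0}"
| "representatives Fam_2b = {Z2 * (Z1 - Cst \<alpha> * Z2) + Cst \<gamma> | \<alpha> \<gamma>. \<alpha> \<notin> \<real>}"
| "representatives Fam_2c1 = {Z1\<^sup>2 + Z2\<^sup>2 + Cst \<gamma> | \<gamma>. True}"
| "representatives Fam_2c2 = {(Z1 - Cst \<i> * Z2) * (Z1 - Cst \<alpha> * Z2) + Cst \<gamma> | \<alpha> \<gamma>.
     \<alpha> \<notin> \<real> \<and> \<alpha> \<noteq> \<i> \<and> \<alpha> \<noteq> - \<i>}"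


lemma finite_coeff2: "finite {i + j | i j. coeff2 p i j \<noteq> 0}"
proof (rule finite_subset)
  show "{i + j | i j. coeff2 p i j \<noteq> 0} \<subseteq> (\<lambda>(j, i). i + j) ` (SIGMA j:{..degree p}. {..degree (coeff p j)})"
  proof
    fix n assume "n \<in> {i + j | i j. coeff2 p i j \<noteq> 0}"
    then obtain i j where ij: "n = i + j" "coeff (coeff p j) i \<noteq> 0"
      unfolding coeff2_def by blast
    then have "coeff p j \<noteq> 0" by (metis coeff_0)
    then have "(j, i) \<in> (SIGMA j:{..degree p}. {..degree (coeff p j)})"
      using ij(2) by (simp add: le_degree)
    then show "n \<in> (\<lambda>(j, i). i + j) ` (SIGMA j:{..degree p}. {..degree (coeff p j)})"
      by (rule rev_image_eqI) (simp add: ij(1))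
  qed
  show "finite ((\<lambda>(j, i). i + j) ` (SIGMA j:{..degree p}. {..degree (coeff p j)}))"
    by (intro finite_imageI finite_SigmaI finite_atMost)
qed

lemma conic_normal: "Cst a * Z1\<^sup>2 + Cst b * Z1 * Z2 + Cst c * Z2\<^sup>2 + Cst d * Z1 + Cst e * Z2 + Cst f
   = [:[:f, d, a:], [:e, b:], [:c:]:]"
  by (simp add: Cst_def Z1_def Z2_def power2_eq_square)

lemma conics_iff:
  "p \<in> conics \<longleftrightarrow> (\<exists>a b c d e f. (a, b, c) \<noteq> (0, 0, 0) \<and>
     p = Cst a * Z1\<^sup>2 + Cst b * Z1 * Z2 + Cst c * Z2\<^sup>2 + Cst d * Z1 + Cst e * Z2 + Cst f)"
proof
  let ?S = "insert 0 {i + j | i j. coeff2 p i j \<noteq> 0}"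
  have fin: "finite ?S" using finite_coeff2 by simp
  assume "p \<in> conics"
  then have M: "Max ?S = 2" by (simp add: conics_def total_degree_def)
  have z: "coeff (coeff p j) i = 0" if "i + j > 2" for i j
    using Max_ge[OF fin, of "i + j"] M that by (auto simp: coeff2_def)
  have "2 \<in> ?S" using Max_in[OF fin] M by auto
  then obtain i j where ij: "coeff (coeff p j) i \<noteq> 0" "i + j = 2" by (auto simp: coeff2_def)
  let ?c = "\<lambda>i j. coeff (coeff p j) i"
  have "p = [:[:?c 0 0, ?c 1 0, ?c 2 0:], [:?c 0 1, ?c 1 1:], [:?c 0 2:]:]"
    by (intro poly_eqI) (auto simp: coeff_pCons numeral_2_eq_2 z split: nat.split)
  moreover have "(?c 2 0, ?c 1 1, ?c 0 2) \<noteq> (0, 0, 0)"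
  proof -
    have "(i = 2 \<and> j = 0) \<or> (i = 1 \<and> j = 1) \<or> (i = 0 \<and> j = 2)" using ij(2) by auto
    with ij(1) show ?thesis by auto
  qed
  ultimately show "\<exists>a b c d e f. (a, b, c) \<noteq> (0, 0, 0) \<and>
     p = Cst a * Z1\<^sup>2 + Cst b * Z1 * Z2 + Cst c * Z2\<^sup>2 + Cst d * Z1 + Cst e * Z2 + Cst f"
    unfolding conic_normal by blast
next
  assume "\<exists>a b c d e f. (a, b, c) \<noteq> (0, 0, 0) \<and>
     p = Cst a * Z1\<^sup>2 + Cst b * Z1 * Z2 + Cst c * Z2\<^sup>2 + Cst d * Z1 + Cst e * Z2 + Cst f"
  then obtain a b c d e f where nz: "(a, b, c) \<noteq> (0, 0, 0)" and
    p: "p = [:[:f, d, a:], [:e, b:], [:c:]:]" unfolding conic_normal by blast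
  have "coeff2 p 2 0 = a" "coeff2 p 1 1 = b" "coeff2 p 0 2 = c"
    by (simp_all add: p coeff2_def numeral_2_eq_2)
  moreover have "coeff2 p 2 0 \<noteq> 0 \<or> coeff2 p 1 1 \<noteq> 0 \<or> coeff2 p 0 2 \<noteq> 0"
    using calculation nz by auto
  then have "\<exists>i j. 2 = i + j \<and> coeff2 p i j \<noteq> 0"
  proof (elim disjE)
    show ?thesis if "coeff2 p 2 0 \<noteq> 0" using that by (intro exI[of _ 2] exI[of _ 0]) simp
    show ?thesis if "coeff2 p 1 1 \<noteq> 0" using that by (intro exI[of _ 1]) simp
    show ?thesis if "coeff2 p 0 2 \<noteq> 0" using that by (intro exI[of _ 0] exI[of _ 2]) simp
  qed
  moreover have "i + j \<le> 2" if "coeff2 p i j \<noteq> 0" for i j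
    using that by (auto simp: p coeff2_def coeff_pCons split: nat.splits)
  ultimately have "Max (insert 0 {i + j | i j. coeff2 p i j \<noteq> 0}) = 2"
    using finite_coeff2[of p] by (intro Max_eqI) auto
  then show "p \<in> conics" by (simp add: conics_def total_degree_def)
qed

lemma initial_form_conic:
  "initial_form (Cst a * Z1\<^sup>2 + Cst b * Z1 * Z2 + Cst c * Z2\<^sup>2 + Cst d * Z1 + Cst e * Z2 + Cst f)
     = Cst a * Z1\<^sup>2 + Cst b * Z1 * Z2 + Cst c * Z2\<^sup>2"
  unfolding conic_normal by (simp add: initial_form_def coeff2_def numeral_2_eq_2)

context
  fixes h :: "'a :: comm_ring_1 \<Rightarrow> 'b :: comm_ring_1"
  assumes h0: "h 0 = 0" and hadd: "\<And>x y. h (x + y) = h x + h y"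
    and hmult: "\<And>x y. h (x * y) = h x * h y"
begin

lemma eval_hom_pCons: "poly (map_poly h (pCons a p)) x = h a + x * poly (map_poly h p) x"
  by (simp add: map_poly_pCons h0)

lemma eval_hom_add: "poly (map_poly h (p + q)) x = poly (map_poly h p) x + poly (map_poly h q) x"
  by (induction p q rule: poly_induct2) (simp_all add: map_poly_pCons h0 hadd algebra_simps)

lemma eval_hom_smult: "poly (map_poly h (smult a p)) x = h a * poly (map_poly h p) x"
  by (induction p) (simp_all add: map_poly_pCons h0 hmult algebra_simps)

lemma eval_hom_mult: "poly (map_poly h (p * q)) x = poly (map_poly h p) x * poly (map_poly h q) x"
  by (induction p) (simp_all add: map_poly_pCons h0 eval_hom_add eval_hom_smult algebra_simps)

end

lemma Cst_add: "Cst (a + b) = Cst a + Cst b"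
  and Cst_0: "Cst 0 = 0" and Cst_1: "Cst 1 = 1"
  by (simp_all add: Cst_def one_pCons)

lemmas Cst_eval = eval_hom_pCons[OF Cst_0 Cst_add Cst_mult] eval_hom_add[OF Cst_0 Cst_add Cst_mult]
   eval_hom_mult[OF Cst_0 Cst_add Cst_mult]

lemma subst2_add: "subst2 (p + q) P Q = subst2 p P Q + subst2 q P Q"
  unfolding subst2_def by (rule eval_hom_add) (simp_all add: Cst_eval)

lemma subst2_mult: "subst2 (p * q) P Q = subst2 p P Q * subst2 q P Q"
  unfolding subst2_def by (rule eval_hom_mult) (simp_all add: Cst_eval)

lemma subst2_Cst: "subst2 (Cst c) P Q = Cst c"
  unfolding subst2_def by (simp add: Cst_def map_poly_pCons)

lemma subst2_Z1: "subst2 Z1 P Q = P"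
  unfolding subst2_def by (simp add: Z1_def map_poly_pCons Cst_0 Cst_1)

lemma subst2_Z2: "subst2 Z2 P Q = Q"
  unfolding subst2_def by (simp add: Z2_def map_poly_pCons Cst_0 Cst_1)

lemmas subst2_simps = subst2_add subst2_mult subst2_Cst subst2_Z1 subst2_Z2

lemma cpoly2_induct [case_names Cst Z1 Z2 add mult]:
  assumes "\<And>c. P (Cst c)" "P Z1" "P Z2" "\<And>p q. P p \<Longrightarrow> P q \<Longrightarrow> P (p + q)"
    "\<And>p q. P p \<Longrightarrow> P q \<Longrightarrow> P (p * q)"
  shows "P p"
proof (induction p)
  case 0
  show ?case using assms(1)[of 0] by (simp add: Cst_def)
next
  case (pCons r p)
  have "P [:r:]"
  proof (induction r)
    case 0
    show ?case using assms(1)[of 0] by (simp add: Cst_def)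
  next
    case (pCons a r)
    have "[:pCons a r:] = Cst a + Z1 * [:r:]" by (simp add: Cst_def Z1_def)
    then show ?case using assms pCons by metis
  qed
  moreover have "pCons r p = [:r:] + Z2 * p" by (simp add: Z2_def)
  ultimately show ?case using assms pCons by metis
qed

lemma subst2_subst2: "subst2 (subst2 p P Q) R S = subst2 p (subst2 P R S) (subst2 Q R S)"
  by (induction p rule: cpoly2_induct) (simp_all add: subst2_simps)

lemma subst2_id: "subst2 p Z1 Z2 = p"
  by (induction p rule: cpoly2_induct) (simp_all add: subst2_simps)

lemma G2_act_Cst_mult: "G2_act g (Cst c * p) = Cst c * G2_act g p"
  by (cases g) (simp add: subst2_simps)

lemma G2_act_id: "G2_act (mat 1, 0) p = p"
  by (simp add: mat_def Cst_0 Cst_1 subst2_id)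

lemma G2_act_comp:
  "G2_act (B, c) (G2_act (A, b) p) =
     G2_act (A ** B, (\<chi> i. (\<Sum>j\<in>UNIV. of_real (A$i$j) * c$j) + b$i)) p"
  by (simp add: subst2_subst2 subst2_simps matrix_matrix_mult_def sum_2 Cst_add Cst_mult algebra_simps)

lemma G2_equivI:
  assumes "p \<in> conics" "q \<in> conics" "invertible A" "c \<noteq> 0" "q = Cst c * G2_act (A, b) p"
  shows "(p, q) \<in> G2_equiv"
  unfolding G2_equiv_def mem_Collect_eq case_prod_conv
  using assms by (intro conjI bexI[of _ "(A, b)"] exI[of _ c]) (simp_all add: G2_def)

lemma G2_equivE:
  assumes "(p, q) \<in> G2_equiv"
  obtains A b c where "p \<in> conics" "q \<in> conics" "invertible A" "c \<noteq> 0"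
    "q = Cst c * G2_act (A, b) p"
  using assms unfolding G2_equiv_def G2_def by blast

lemma equiv_G2_equiv: "equiv conics G2_equiv"
proof (rule equivI)
  show "G2_equiv \<subseteq> conics \<times> conics" by (auto simp: G2_equiv_def)
  show "refl_on conics G2_equiv"
  proof (rule refl_onI)
    fix p assume "p \<in> conics"
    moreover have "invertible (mat 1 :: real^2^2)"
      unfolding invertible_def by (rule exI[of _ "mat 1"]) simp
    moreover have "p = Cst 1 * G2_act (mat 1, 0) p" by (simp only: G2_act_id Cst_1 mult_1)
    ultimately show "(p, p) \<in> G2_equiv" by (intro G2_equivI) (assumption | rule one_neq_zero)+
  qed
  show "trans G2_equiv"
  proof (rule transI)
    fix p q r assume "(p, q) \<in> G2_equiv" "(q, r) \<in> G2_equiv"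
    then obtain A b c B d e where *: "p \<in> conics" "r \<in> conics" "invertible A" "invertible B"
      "c \<noteq> 0" "e \<noteq> 0" "q = Cst c * G2_act (A, b) p" "r = Cst e * G2_act (B, d) q"
      by (elim G2_equivE) (rule that)
    then have "r = Cst (e * c) *
      G2_act (A ** B, (\<chi> i. (\<Sum>j\<in>UNIV. of_real (A$i$j) * d$j) + b$i)) p"
      by (simp only: G2_act_Cst_mult G2_act_comp Cst_mult mult.assoc)
    moreover have "invertible (A ** B)" using * by (simp add: invertible_mult)
    moreover have "e * c \<noteq> 0" using * by simp
    ultimately show "(p, r) \<in> G2_equiv" using *(1,2) by (intro G2_equivI)
  qed
  show "sym G2_equiv"
  proof (rule symI)
    fix p q assume "(p, q) \<in> G2_equiv"
    then obtain A b c where *: "p \<in> conics" "q \<in> conics" "invertible A"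
      "c \<noteq> 0" "q = Cst c * G2_act (A, b) p"
      by (elim G2_equivE) (rule that)
    from *(3) obtain B where B: "A ** B = mat 1" "B ** A = mat 1" by (auto simp: invertible_def)
    define d :: "complex^2" where "d = (\<chi> i. - (\<Sum>j\<in>UNIV. of_real (B$i$j) * b$j))"
    have 1: "A$1$1 * B$1$1 + A$1$2 * B$2$1 = 1" "A$1$1 * B$1$2 + A$1$2 * B$2$2 = 0"
      "A$2$1 * B$1$1 + A$2$2 * B$2$1 = 0" "A$2$1 * B$1$2 + A$2$2 * B$2$2 = 1"
      using B(1) by (auto simp: matrix_matrix_mult_def mat_def vec_eq_iff forall_2 sum_2)
    have 2: "complex_of_real (A$1$1) * B$1$1 + A$1$2 * B$2$1 = 1" "complex_of_real (A$1$1) * B$1$2 + A$1$2 * B$2$2 = 0"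
      "complex_of_real (A$2$1) * B$1$1 + A$2$2 * B$2$1 = 0" "complex_of_real (A$2$1) * B$1$2 + A$2$2 * B$2$2 = 1"
      using 1[THEN arg_cong[of _ _ complex_of_real]]
      by (simp_all only: of_real_add of_real_mult of_real_1 of_real_0)
    have "(\<Sum>j\<in>UNIV. of_real (A$1$j) * d$j) + b$1 =
       b$1 - (complex_of_real (A$1$1) * B$1$1 + A$1$2 * B$2$1) * b$1 - (complex_of_real (A$1$1) * B$1$2 + A$1$2 * B$2$2) * b$2"
      by (simp add: d_def sum_2 algebra_simps)
    moreover have "(\<Sum>j\<in>UNIV. of_real (A$2$j) * d$j) + b$2 =
       b$2 - (complex_of_real (A$2$1) * B$1$1 + A$2$2 * B$2$1) * b$1 - (complex_of_real (A$2$1) * B$1$2 + A$2$2 * B$2$2) * b$2"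
      by (simp add: d_def sum_2 algebra_simps)
    ultimately have "(\<chi> i. (\<Sum>j\<in>UNIV. of_real (A$i$j) * d$j) + b$i) = 0"
      unfolding 2 by (simp add: vec_eq_iff forall_2)
    then have inv: "G2_act (B, d) (G2_act (A, b) p) = p"
      by (simp only: G2_act_comp B G2_act_id)
    have "Cst (inverse c) * G2_act (B, d) q = Cst (inverse c * c) * p"
      unfolding *(5) G2_act_Cst_mult inv Cst_mult mult.assoc ..
    then have "p = Cst (inverse c) * G2_act (B, d) q"
      by (simp only: left_inverse[OF *(4)] Cst_1 mult_1)
    moreover have "invertible B" using B by (auto simp: invertible_def)
    moreover have "inverse c \<noteq> 0" using *(4) by simp
    ultimately show "(q, p) \<in> G2_equiv" using *(1,2) by (intro G2_equivI)
  qed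
qed

end

theory Submission
  imports Defs
begin

text \<open>
  A conic is moved by G2 in two steps. A real linear map acts on the two roots of the initial form
  by its adjugate, so it can normalise a real root to (0:1) or (1:0), a non-real root to (i:1), and
  two distinct real roots simultaneously. Then a translation completes the square: it kills the
  linear part if the roots are distinct, and leaves at most a multiple of z2 if they coincide.
  The families are separated by invariants. Equality and reality of roots are preserved by real
  linear maps; within one arrangement, the vanishing of the determinant of the conic separates
  (1a.1) from (1a.2) and (2a.1) from (2a.2), while (2c.1) is the case where the initial form is
  proportional to a real form. In family (1a.1) the parameter is determined up to a positive
  real factor, so there are infinitely many orbits.
\<close>

section \<open>Conics as coefficient lists\<close>

text \<open>The list form, with \<open>Z2\<close> as outer variable, replaces the sum of monomials
  because equality of conics then reduces to equality of coefficients by injectivity of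
  \<open>pCons\<close>.\<close>

definition conic_of :: "complex \<Rightarrow> complex \<Rightarrow> complex \<Rightarrow> complex \<Rightarrow> complex \<Rightarrow> complex \<Rightarrow> cpoly2" where
  "conic_of a b c d e f = [:[:f, d, a:], [:e, b:], [:c:]:]"

lemma conic_eq_iff:
  "conic_of a b c d e f = conic_of a' b' c' d' e' f' \<longleftrightarrow>
     a = a' \<and> b = b' \<and> c = c' \<and> d = d' \<and> e = e' \<and> f = f'"
  by (auto simp: conic_of_def)

lemma conic_mem_conics: "conic_of a b c d e f \<in> conics \<longleftrightarrow> a \<noteq> 0 \<or> b \<noteq> 0 \<or> c \<noteq> 0"
proof -
  have "conic_of a b c d e f \<in> conics \<longleftrightarrow>
     (\<exists>a' b' c' d' e' f'. (a', b', c') \<noteq> (0, 0, 0) \<and>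
     conic_of a b c d e f = conic_of a' b' c' d' e' f')"
    unfolding conics_iff conic_normal conic_of_def[symmetric] ..
  then show ?thesis by (auto simp: conic_eq_iff)
qed

lemma conicsE:
  assumes "p \<in> conics"
  obtains a b c d e f where "p = conic_of a b c d e f" "a \<noteq> 0 \<or> b \<noteq> 0 \<or> c \<noteq> 0"
  using assms unfolding conics_iff conic_normal conic_of_def[symmetric] by auto

lemma initial_form_conic_coeffs: "initial_form (conic_of a b c d e f) = conic_of a b c 0 0 0"
proof -
  have "initial_form (conic_of a b c d e f) = Cst a * Z1\<^sup>2 + Cst b * Z1 * Z2 + Cst c * Z2\<^sup>2"
    using initial_form_conic[of a b c d e f] unfolding conic_normal conic_of_def .
  also have "\<dots> = conic_of a b c 0 0 0"
    by (simp add: conic_of_def Cst_def Z1_def Z2_def power2_eq_square)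
  finally show ?thesis .
qed

lemma Cst_mult_conic:
  "Cst k * conic_of a b c d e f = conic_of (k * a) (k * b) (k * c) (k * d) (k * e) (k * f)"
  by (simp add: Cst_def conic_of_def)

lemma subst2_conic:
  "subst2 (conic_of a b c d e f) (Cst p * Z1 + Cst q * Z2 + Cst s) (Cst r * Z1 + Cst w * Z2 + Cst t) =
   conic_of (a * p\<^sup>2 + b * p * r + c * r\<^sup>2)
     (2 * a * p * q + b * (p * w + q * r) + 2 * c * r * w)
     (a * q\<^sup>2 + b * q * w + c * w\<^sup>2)
     (2 * a * p * s + b * (p * t + r * s) + 2 * c * r * t + d * p + e * r)
     (2 * a * q * s + b * (q * t + w * s) + 2 * c * w * t + d * q + e * w)
     (a * s\<^sup>2 + b * s * t + c * t\<^sup>2 + d * s + e * t + f)"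
  unfolding conic_of_def conic_normal[symmetric]
  by (simp add: subst2_simps power2_eq_square) 
    (simp add: Cst_def Z1_def Z2_def algebra_simps)

section \<open>Linear forms as primes of the polynomial ring\<close>

text \<open>The linear form with root (x:y).\<close>

definition lform :: "complex \<Rightarrow> complex \<Rightarrow> cpoly2" where
  "lform x y = Cst y * Z1 - Cst x * Z2"

lemma lform_mult:
  "lform x y * lform x' y' = conic_of (y * y') (- (x * y' + y * x')) (x * x') 0 0 0"
  by (simp add: lform_def conic_of_def Cst_def Z1_def Z2_def algebra_simps)

lemma lform_scale: "lform (c * x) (c * y) = Cst c * lform x y"
  by (simp add: lform_def Cst_mult algebra_simps)

text \<open>With L = m z1 + n z2, the normalisation gives z1 = x L + n (\<open>lform x y\<close>)
  and z2 = y L - m (\<open>lform x y\<close>). So the substitution is reduction modulo the linear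
  form: this is checked on generators and passes to sums and products.\<close>

lemma lform_dvd_diff_subst2:
  assumes "x * m + y * n = 1"
  shows "lform x y dvd q - subst2 q (Cst x * (Cst m * Z1 + Cst n * Z2)) (Cst y * (Cst m * Z1 + Cst n * Z2))"
    (is "_ dvd q - subst2 q ?P ?Q")
proof (induction q rule: cpoly2_induct)
  case (Cst c)
  then show ?case by (simp add: subst2_simps)
next
  case Z1
  have "1 - x * m = y * n" using assms by (simp add: algebra_simps)
  then have "Z1 - ?P = Cst n * lform x y"
    by (simp add: lform_def Cst_def Z1_def Z2_def algebra_simps)
  then show ?case by (simp add: subst2_simps)
next
  case Z2
  have "Z2 - ?Q = Cst (-m) * lform x y"
    using assms by (simp add: lform_def Cst_def Z1_def Z2_def algebra_simps one_pCons)
  then show ?case by (simp add: subst2_simps)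
next
  case (add p q)
  then show ?case by (simp add: subst2_simps) (metis add_diff_add dvd_add)
next
  case (mult p q)
  have "p * q - subst2 p ?P ?Q * subst2 q ?P ?Q =
      (p - subst2 p ?P ?Q) * q + subst2 p ?P ?Q * (q - subst2 q ?P ?Q)"
    by (simp add: algebra_simps)
  with mult show ?case by (simp add: subst2_simps)
qed

text \<open>The substitution is a ring homomorphism that kills the linear form and is the identity
  modulo it, so its kernel is the ideal generated by the form. Divisibility can then be tested by
  computation.\<close>

lemma lform_dvd_iff:
  assumes "x * m + y * n = 1"
  shows "lform x y dvd q \<longleftrightarrow>
    subst2 q (Cst x * (Cst m * Z1 + Cst n * Z2)) (Cst y * (Cst m * Z1 + Cst n * Z2)) = 0"
    (is "_ \<longleftrightarrow> subst2 q ?P ?Q = 0")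
proof
  assume "lform x y dvd q"
  then obtain r where "q = lform x y * r" by (elim dvdE)
  moreover have "subst2 (lform x y) ?P ?Q = 0"
  proof -
    have "lform x y = Cst y * Z1 + Cst (-x) * Z2" by (simp add: lform_def Cst_def Z1_def Z2_def)
    then show ?thesis by (simp only: subst2_simps) (simp add: Cst_def Z1_def Z2_def algebra_simps)
  qed
  ultimately show "subst2 q ?P ?Q = 0" by (simp add: subst2_simps)
next
  assume "subst2 q ?P ?Q = 0"
  then show "lform x y dvd q" using lform_dvd_diff_subst2[OF assms, of q] by simp
qed

lemma dual_coords:
  fixes x y :: complex
  assumes "x \<noteq> 0 \<or> y \<noteq> 0"
  obtains m n where "x * m + y * n = 1"
proof (cases "x = 0")
  case True
  then show ?thesis using assms that[of 0 "1 / y"] by simp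
next
  case False
  then show ?thesis using that[of "1 / x" 0] by simp
qed

text \<open>The factor is obtained by pairing \<open>(x', y')\<close> with dual coordinates
  \<open>(m, n)\<close> of \<open>(x, y)\<close>, which avoids dividing by a coordinate that may
  vanish.\<close>

lemma proportional_coords:
  fixes x y x' y' :: complex
  assumes "x \<noteq> 0 \<or> y \<noteq> 0" "x * y' = y * x'"
  obtains k where "x' = k * x" "y' = k * y"
proof -
  obtain m n where mn: "x * m + y * n = 1" using dual_coords[OF assms(1)] .
  have "x' = (x' * m + y' * n) * x" "y' = (x' * m + y' * n) * y"
    using mn assms(2) by algebra+
  then show ?thesis by (rule that)
qed

text \<open>The multiples of the form are the kernel of a homomorphism into an integral domain.
  Primality is what makes root multiplicities additive over products.\<close>

lemma prime_elem_lform: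
  assumes "x \<noteq> 0 \<or> y \<noteq> 0"
  shows "prime_elem (lform x y)"
proof -
  obtain m n where mn: "x * m + y * n = 1" using dual_coords[OF assms] .
  have "lform x y \<noteq> 0" using assms by (auto simp: lform_def Cst_def Z1_def Z2_def)
  moreover have "\<not> lform x y dvd 1"
    using subst2_Cst[of 1] by (simp add: lform_dvd_iff[OF mn] Cst_1)
  ultimately show ?thesis
    by (intro prime_elemI) (auto simp: lform_dvd_iff[OF mn] subst2_mult)
qed

text \<open>The substitution that kills \<open>lform x y\<close> turns the other form into
  \<open>x * y' - y * x'\<close> times the nonzero form m z1 + n z2.\<close>

lemma lform_dvd_lform_iff:
  assumes "x \<noteq> 0 \<or> y \<noteq> 0"
  shows "lform x y dvd lform x' y' \<longleftrightarrow> x * y' = y * x'"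
proof -
  obtain m n where mn: "x * m + y * n = 1" using dual_coords[OF assms] .
  have eq: "lform x' y' = Cst y' * Z1 + Cst (-x') * Z2" by (simp add: lform_def Cst_def Z1_def Z2_def)
  have "lform x y dvd lform x' y' \<longleftrightarrow> 
    Cst (x * y' - y * x') * (Cst m * Z1 + Cst n * Z2) = 0"
    unfolding lform_dvd_iff[OF mn] eq
    by (simp only: subst2_simps) (simp add: Cst_def Z1_def Z2_def algebra_simps)
  moreover have "Cst m * Z1 + Cst n * Z2 \<noteq> 0"
    using mn by (auto simp: Cst_def Z1_def Z2_def)
  ultimately show ?thesis by (simp add: Cst_def)
qed

lemma multiplicity_lform_lform:
  assumes "x \<noteq> 0 \<or> y \<noteq> 0" "x' \<noteq> 0 \<or> y' \<noteq> 0"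
  shows "multiplicity (lform x y) (lform x' y') = of_bool (x * y' = y * x')"
proof (cases "x * y' = y * x'")
  case False
  then show ?thesis using lform_dvd_lform_iff[OF assms(1)] by (simp add: not_dvd_imp_multiplicity_0)
next
  case True
  obtain k where k: "x' = k * x" "y' = k * y" using proportional_coords[OF assms(1) True] .
  then have "k \<noteq> 0" using assms(2) by auto
  then show ?thesis
    using True prime_elem_lform[OF assms(1)] unfolding k lform_scale
    by (simp add: multiplicity_times_unit_right is_unit_Cst)
qed

section \<open>Homogeneous coordinates on the projective line\<close>

text \<open>The pair \<open>(0, 0)\<close> lies outside the domain of the partial quotient, which is
  why facts about \<open>pt\<close> assume a nonzero coordinate.\<close>

definition pt :: "complex \<Rightarrow> complex \<Rightarrow> cproj1" where
  "pt x y = abs_cproj1 (vector [x, y])"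

lemma proportional_vector_refl:
  assumes "x \<noteq> 0 \<or> y \<noteq> 0"
  shows "proportional (vector [x, y]) (vector [x, y])"
  using assms by (auto simp: proportional_def vec_eq_iff forall_2 intro!: exI[of _ 1])

lemma proportional_vector_iff:
  assumes "x \<noteq> 0 \<or> y \<noteq> 0" "x' \<noteq> 0 \<or> y' \<noteq> 0"
  shows "proportional (vector [x, y]) (vector [x', y']) \<longleftrightarrow> x * y' = y * x'"
proof
  assume "proportional (vector [x, y]) (vector [x', y'])"
  then show "x * y' = y * x'" by (auto simp: proportional_def vec_eq_iff forall_2)
next
  assume eq: "x * y' = y * x'"
  obtain k where k: "x' = k * x" "y' = k * y" using proportional_coords[OF assms(1) eq] .
  then show "proportional (vector [x, y]) (vector [x', y'])"
    using assms by (auto simp: proportional_def vec_eq_iff forall_2 intro!: exI[of _ k])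
qed

lemma cproj1_cases:
  obtains x y where "P = pt x y" "x \<noteq> 0 \<or> y \<noteq> 0"
proof -
  define w where "w = rep_cproj1 P"
  have "proportional w w" unfolding w_def by (rule Quotient_rep_reflp[OF Quotient_cproj1])
  then have "w \<noteq> 0" by (simp add: proportional_def)
  then have "w$1 \<noteq> 0 \<or> w$2 \<noteq> 0" by (auto simp: vec_eq_iff forall_2)
  moreover have "vector [w$1, w$2] = w" by (simp add: vec_eq_iff forall_2)
  moreover have "P = abs_cproj1 w" unfolding w_def by (simp add: Quotient_abs_rep[OF Quotient_cproj1])
  ultimately show ?thesis using that[of "w$1" "w$2"] by (simp add: pt_def)
qed

lemma pt_eq_iff:
  assumes "x \<noteq> 0 \<or> y \<noteq> 0" "x' \<noteq> 0 \<or> y' \<noteq> 0"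
  shows "pt x y = pt x' y' \<longleftrightarrow> x * y' = y * x'"
  using Quotient_rel[OF Quotient_cproj1, of "vector [x, y]" "vector [x', y']"]
    proportional_vector_refl[OF assms(1)] proportional_vector_refl[OF assms(2)]
    proportional_vector_iff[OF assms]
  by (simp add: pt_def)

lemma root_order_pt:
  assumes "x \<noteq> 0 \<or> y \<noteq> 0"
  shows "root_order q (pt x y) = multiplicity (lform x y) q"
  using root_order.abs_eq[OF proportional_vector_refl[OF assms]] by (simp add: pt_def lform_def)

text \<open>Scaling by a nonzero c multiplies \<open>x * cnj y\<close> by the positive number |c|
  squared. Conversely, if this product is real, multiplying by \<open>cnj y\<close>, or by
  \<open>cnj x\<close> when \<open>y = 0\<close>, makes both coordinates real.\<close>

lemma real_point_pt:
  assumes "x \<noteq> 0 \<or> y \<noteq> 0"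
  shows "real_point (pt x y) \<longleftrightarrow> Im (x * cnj y) = 0"
proof -
  have "(\<exists>c. c \<noteq> 0 \<and> c * x \<in> \<real> \<and> c * y \<in> \<real>) \<longleftrightarrow> Im (x * cnj y) = 0"
  proof
    assume "\<exists>c. c \<noteq> 0 \<and> c * x \<in> \<real> \<and> c * y \<in> \<real>"
    then obtain c where c: "c \<noteq> 0" "c * x \<in> \<real>" "c * y \<in> \<real>" by blast
    then have "(c * x) * cnj (c * y) \<in> \<real>" by (metis Reals_cnj_iff Reals_mult)
    moreover have "(c * x) * cnj (c * y) = of_real ((cmod c)\<^sup>2) * (x * cnj y)"
      unfolding complex_norm_square by (simp add: algebra_simps)
    ultimately have "of_real ((cmod c)\<^sup>2) * (x * cnj y) \<in> \<real>" by argo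
    then have "Im (of_real ((cmod c)\<^sup>2) * (x * cnj y)) = 0" by (simp only: complex_is_Real_iff)
    then have "(cmod c)\<^sup>2 * Im (x * cnj y) = 0" by (simp only: Im_complex_of_real Re_complex_of_real times_complex.simps)
    then show "Im (x * cnj y) = 0" using c(1) by simp
  next
    assume im: "Im (x * cnj y) = 0"
    show "\<exists>c. c \<noteq> 0 \<and> c * x \<in> \<real> \<and> c * y \<in> \<real>"
    proof (cases "y = 0")
      case True
      with assms show ?thesis by (intro exI[of _ "cnj x"]) (simp add: complex_is_Real_iff)
    next
      case False
      with im show ?thesis by (intro exI[of _ "cnj y"]) (simp add: complex_is_Real_iff algebra_simps)
    qed
  qed
  then show ?thesis
    using real_point.abs_eq[OF proportional_vector_refl[OF assms]] by (simp add: pt_def)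
qed

section \<open>Roots of the initial form and their arrangement\<close>

definition arrangement :: "cproj1 \<Rightarrow> cproj1 \<Rightarrow> root_arrangement" where
  "arrangement P Q =
     (if P = Q then if real_point P then Double_Real else Double_Nonreal
      else if real_point P \<and> real_point Q then Two_Real
      else if real_point P \<or> real_point Q then Real_Nonreal
      else Two_Nonreal)"

text \<open>The multiplicities recover \<open>P\<close> and \<open>Q\<close> up to order, so exactly
  one of the five arrangements holds.\<close>

lemma has_arrangement_if_root_order:
  assumes "\<And>R. root_order q R = of_bool (R = P) + of_bool (R = Q)"
  shows "has_arrangement q A \<longleftrightarrow> A = arrangement P Q"
  by (cases A) (auto simp: assms arrangement_def)

text \<open>Since a conic has a nonzero initial form, the factor and both coordinate pairs are nonzero.\<close>

definition roots :: "cpoly2 \<Rightarrow> complex \<Rightarrow> complex \<Rightarrow> complex \<Rightarrow> complex \<Rightarrow> bool" where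
  "roots p x y x' y' \<longleftrightarrow> p \<in> conics \<and> (\<exists>k. initial_form p = Cst k * (lform x y * lform x' y'))"

lemma rootsE:
  assumes "roots p x y x' y'"
  obtains k where "k \<noteq> 0" "x \<noteq> 0 \<or> y \<noteq> 0" "x' \<noteq> 0 \<or> y' \<noteq> 0"
    "initial_form p = Cst k * (lform x y * lform x' y')"
proof -
  obtain k where p: "p \<in> conics" and k: "initial_form p = Cst k * (lform x y * lform x' y')"
    using assms unfolding roots_def by blast
  from p obtain a b c d e f where "p = conic_of a b c d e f" "a \<noteq> 0 \<or> b \<noteq> 0 \<or> c \<noteq> 0"
    by (rule conicsE)
  with k have abc: "a = k * (y * y')" "b = k * - (x * y' + y * x')" "c = k * (x * x')"
    and nz: "a \<noteq> 0 \<or> b \<noteq> 0 \<or> c \<noteq> 0"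
    by (simp_all add: initial_form_conic_coeffs lform_mult Cst_mult_conic conic_eq_iff)
  have "k \<noteq> 0" "x \<noteq> 0 \<or> y \<noteq> 0" "x' \<noteq> 0 \<or> y' \<noteq> 0"
    using nz unfolding abc by auto
  then show ?thesis using k that by blast
qed

text \<open>The multiplicity of a prime linear form is additive over the two factors, and the
  constant is a unit.\<close>

lemma has_arrangement_iff:
  assumes "roots p x y x' y'"
  shows "has_arrangement (initial_form p) A \<longleftrightarrow> A = arrangement (pt x y) (pt x' y')"
proof (rule has_arrangement_if_root_order)
  fix R
  obtain k where k: "k \<noteq> 0" and nz: "x \<noteq> 0 \<or> y \<noteq> 0" "x' \<noteq> 0 \<or> y' \<noteq> 0"
    and p: "initial_form p = Cst k * (lform x y * lform x' y')"
    using assms by (rule rootsE)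
  obtain r s where R: "R = pt r s" and rs: "r \<noteq> 0 \<or> s \<noteq> 0" by (rule cproj1_cases)
  have "lform x y \<noteq> 0" "lform x' y' \<noteq> 0"
    using prime_elem_lform[OF nz(1)] prime_elem_lform[OF nz(2)] by auto
  then show "root_order (initial_form p) R = of_bool (R = pt x y) + of_bool (R = pt x' y')"
    unfolding p R root_order_pt[OF rs] pt_eq_iff[OF rs nz(1)] pt_eq_iff[OF rs nz(2)]
    using prime_elem_lform[OF rs] rs nz
    by (simp add: multiplicity_times_unit_right[OF is_unit_Cst[OF k]]
        prime_elem_multiplicity_mult_distrib multiplicity_lform_lform)
qed

lemma roots_exist:
  assumes "p \<in> conics"
  obtains x y x' y' where "roots p x y x' y'"
proof -
  from assms obtain a b c d e f where p: "p = conic_of a b c d e f" and nz: "a \<noteq> 0 \<or> b \<noteq> 0 \<or> c \<noteq> 0"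
    by (rule conicsE)
  show ?thesis
  proof (cases "a = 0")
    case True
    \<comment> \<open>Here \<open>lform 1 0\<close> is \<open>- Z2\<close>, and an initial form
      without its first term is z2 (b z1 + c z2).\<close>
    have "initial_form p = Cst (-1) * (lform 1 0 * lform (-c) b)"
      by (simp add: p initial_form_conic_coeffs lform_mult Cst_mult_conic conic_eq_iff True)
    then show ?thesis using assms that unfolding roots_def by blast
  next
    case False
    \<comment> \<open>The quadratic formula for the ratio z1 / z2.\<close>
    define w where "w = csqrt (b\<^sup>2 - 4 * a * c)"
    have w: "w\<^sup>2 = b\<^sup>2 - 4 * a * c" by (simp add: w_def)
    have "a * ((- b + w) / (2 * a) * ((- b - w) / (2 * a))) = (b\<^sup>2 - w\<^sup>2) / (4 * a)"
      using False by (simp add: field_simps power2_eq_square)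
    also have "\<dots> = c" using False by (simp add: w field_simps)
    finally have "initial_form p = Cst a * (lform ((- b + w) / (2 * a)) 1 * lform ((- b - w) / (2 * a)) 1)"
      using False
      by (simp add: p initial_form_conic_coeffs lform_mult Cst_mult_conic conic_eq_iff) (simp add: field_simps)
    then show ?thesis using assms that unfolding roots_def by blast
  qed
qed

section \<open>Invariants of the group action\<close>

text \<open>Four times the determinant of the symmetric 3 x 3 matrix of the conic.\<close>

definition disc3 :: "cpoly2 \<Rightarrow> complex" where
  "disc3 p = 4 * coeff2 p 2 0 * coeff2 p 0 2 * coeff2 p 0 0 + coeff2 p 1 1 * coeff2 p 1 0 * coeff2 p 0 1
     - coeff2 p 2 0 * (coeff2 p 0 1)\<^sup>2 - coeff2 p 0 2 * (coeff2 p 1 0)\<^sup>2 - coeff2 p 0 0 * (coeff2 p 1 1)\<^sup>2"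

lemma disc3_conic: "disc3 (conic_of a b c d e f) = 4 * a * c * f + b * d * e - a * e\<^sup>2 - c * d\<^sup>2 - f * b\<^sup>2"
  by (simp add: disc3_def coeff2_def conic_of_def numeral_2_eq_2)

text \<open>An affine substitution changes the symmetric matrix of the conic by congruence with a 3
  x 3 matrix whose determinant is that of the linear part; the scalar contributes its cube. One
  implication is computed and the other follows by symmetry of the relation.\<close>

lemma disc3_equiv:
  assumes "(p, q) \<in> G2_equiv"
  shows "disc3 p = 0 \<longleftrightarrow> disc3 q = 0"
proof -
  have dir: "disc3 q = 0" if "disc3 p = 0" "(p, q) \<in> G2_equiv" for p q
  proof -
    from that(2) obtain A b c where p: "p \<in> conics" and q: "q = Cst c * G2_act (A, b) p" 
      by (rule G2_equivE)
    from p obtain a1 a2 a3 a4 a5 a6 where p: "p = conic_of a1 a2 a3 a4 a5 a6" by (rule conicsE)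
    have "disc3 q = c^3 * of_real ((A$1$1 * A$2$2 - A$1$2 * A$2$1)\<^sup>2) * disc3 p"
      unfolding q p G2_act.simps subst2_conic Cst_mult_conic disc3_conic of_real_power of_real_diff of_real_mult
      by algebra
    with that(1) show ?thesis by simp
  qed
  have "(q, p) \<in> G2_equiv" using assms equiv_G2_equiv by (meson equivE symD)
  then show ?thesis using dir assms by blast
qed

text \<open>The roots are transformed by the adjugate of the linear part.\<close>

lemma roots_G2_act:
  fixes x y x' y' :: complex
  assumes "roots p x y x' y'" "invertible A" "k \<noteq> 0" and q_def: "q = Cst k * G2_act (A, t) p"
  shows "roots q (A$2$2 * x - A$1$2 * y) (A$1$1 * y - A$2$1 * x)
    (A$2$2 * x' - A$1$2 * y') (A$1$1 * y' - A$2$1 * x')" and "(p, q) \<in> G2_equiv"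
proof -
  have pc: "p \<in> conics" using assms(1) by (simp add: roots_def)
  obtain l where l: "l \<noteq> 0" and nz: "x \<noteq> 0 \<or> y \<noteq> 0" "x' \<noteq> 0 \<or> y' \<noteq> 0"
    and i: "initial_form p = Cst l * (lform x y * lform x' y')"
    using assms(1) by (rule rootsE)
  from pc obtain a b c d e f where p: "p = conic_of a b c d e f" by (rule conicsE)
  define A11 A12 A21 A22 :: complex where A: "A11 = A$1$1" "A12 = A$1$2" "A21 = A$2$1" "A22 = A$2$2"
  have abc: "a = l * (y * y')" "b = l * - (x * y' + y * x')" "c = l * (x * x')"
    using i by (simp_all add: p initial_form_conic_coeffs lform_mult Cst_mult_conic conic_eq_iff)
  \<comment> \<open>Substituting A z pulls the roots back by the inverse of A. The adjugate is that
    inverse up to the determinant, and with it each linear factor is reproduced exactly.\<close>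
  have iq: "initial_form q = Cst (k * l) * (lform (A22 * x - A12 * y) (A11 * y - A21 * x)
    * lform (A22 * x' - A12 * y') (A11 * y' - A21 * x'))"
    unfolding q_def p G2_act.simps subst2_conic initial_form_conic_coeffs Cst_mult_conic lform_mult
      conic_eq_iff abc A[symmetric]
    by (simp add: power2_eq_square algebra_simps)
  have "det A \<noteq> 0" using assms(2) by (simp add: invertible_det_nz)
  then have "A11 * A22 - A12 * A21 \<noteq> 0"
    unfolding det_2 A by (metis of_real_diff of_real_mult of_real_eq_0_iff)
  \<comment> \<open>A matrix times its adjugate is the determinant, so the adjugate sends no nonzero
    pair to zero.\<close>
  moreover have "(A11 * A22 - A12 * A21) * x = A11 * (A22 * x - A12 * y) + A12 * (A11 * y - A21 * x)"
    "(A11 * A22 - A12 * A21) * y = A21 * (A22 * x - A12 * y) + A22 * (A11 * y - A21 * x)" for x y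
    by (simp_all add: algebra_simps)
  ultimately have adj_nz: "A22 * x - A12 * y \<noteq> 0 \<or> A11 * y - A21 * x \<noteq> 0" if "x \<noteq> 0 \<or> y \<noteq> 0" for x y
    using that by (metis mult_eq_0_iff mult_zero_right add_0)
  have "lform (A22 * x - A12 * y) (A11 * y - A21 * x) \<noteq> 0"
     "lform (A22 * x' - A12 * y') (A11 * y' - A21 * x') \<noteq> 0"
    using prime_elem_lform[OF adj_nz] nz by (metis not_prime_elem_zero)+
  then have "initial_form q \<noteq> 0"
    unfolding iq using assms(3) l by (simp add: Cst_def)
  moreover obtain a' b' c' d' e' f' where q: "q = conic_of a' b' c' d' e' f'"
    unfolding q_def p G2_act.simps subst2_conic Cst_mult_conic by blast
  ultimately have qc: "q \<in> conics"
    by (auto simp: conic_mem_conics initial_form_conic_coeffs) (auto simp: conic_of_def)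
  then show "roots q (A$2$2 * x - A$1$2 * y) (A$1$1 * y - A$2$1 * x)
    (A$2$2 * x' - A$1$2 * y') (A$1$1 * y' - A$2$1 * x')"
    using iq unfolding roots_def A by blast
  show "(p, q) \<in> G2_equiv" by (rule G2_equivI[OF pc qc assms(2,3) q_def])
qed

lemma roots_commute: "roots p x y x' y' \<Longrightarrow> roots p x' y' x y"
  by (simp add: roots_def mult.commute)

lemma roots_scale:
  assumes "roots p x y x' y'" "x = c * u" "y = c * v" "x' = c' * u'" "y' = c' * v'"
  shows "roots p u v u' v'"
proof -
  obtain k where "initial_form p = Cst k * (lform x y * lform x' y')" "p \<in> conics"
    using assms(1) unfolding roots_def by blast
  then have "initial_form p = Cst (k * c * c') * (lform u v * lform u' v')"
    by (simp add: assms(2-5) lform_scale Cst_mult mult_ac)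
  with \<open>p \<in> conics\<close> show ?thesis unfolding roots_def by blast
qed

text \<open>Both \<open>x * y' - y * x'\<close> and \<open>Im (x * cnj y)\<close> are 2 x 2
  determinants, the latter of the imaginary and real parts of the coordinates. A real linear map
  multiplies each by its determinant, so coincidence and reality of the points are kept.\<close>

lemma arrangement_adjugate:
  fixes r s t w :: real
  assumes "x \<noteq> 0 \<or> y \<noteq> 0" "x' \<noteq> 0 \<or> y' \<noteq> 0" and det: "r * w - s * t \<noteq> 0"
    and nz: "of_real w * x - of_real s * y \<noteq> 0 \<or> of_real r * y - of_real t * x \<noteq> 0"
     "of_real w * x' - of_real s * y' \<noteq> 0 \<or> of_real r * y' - of_real t * x' \<noteq> 0"
  shows "arrangement (pt (of_real w * x - of_real s * y) (of_real r * y - of_real t * x))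
     (pt (of_real w * x' - of_real s * y') (of_real r * y' - of_real t * x'))
   = arrangement (pt x y) (pt x' y')"
proof -
  have "(of_real w * x - of_real s * y) * (of_real r * y' - of_real t * x')
      - (of_real r * y - of_real t * x) * (of_real w * x' - of_real s * y')
    = of_real (r * w - s * t) * (x * y' - y * x')"
    by (simp add: algebra_simps)
  then have "(of_real w * x - of_real s * y) * (of_real r * y' - of_real t * x')
      = (of_real r * y - of_real t * x) * (of_real w * x' - of_real s * y') \<longleftrightarrow> x * y' = y * x'"
    using det by (metis eq_iff_diff_eq_0 mult_eq_0_iff of_real_eq_0_iff)
  moreover have "Im ((of_real w * x - of_real s * y) * cnj (of_real r * y - of_real t * x)) = 
    (r * w - s * t) * Im (x * cnj y)" for x y
    by (simp add: algebra_simps)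
  ultimately show ?thesis
    unfolding arrangement_def real_point_pt[OF assms(1)] real_point_pt[OF assms(2)]
      real_point_pt[OF nz(1)] real_point_pt[OF nz(2)] pt_eq_iff[OF assms(1,2)] pt_eq_iff[OF nz]
    using det by simp
qed

lemma has_arrangement_equiv:
  assumes "(p, q) \<in> G2_equiv"
  shows "has_arrangement (initial_form p) A \<longleftrightarrow> has_arrangement (initial_form q) A"
proof -
  obtain B b c where p: "p \<in> conics" and B: "invertible B" and c: "c \<noteq> 0"
    and q: "q = Cst c * G2_act (B, b) p"
    using assms by (rule G2_equivE)
  obtain x y x' y' where r: "roots p x y x' y'" using roots_exist[OF p] .
  have rq: "roots q (B$2$2 * x - B$1$2 * y) (B$1$1 * y - B$2$1 * x)
    (B$2$2 * x' - B$1$2 * y') (B$1$1 * y' - B$2$1 * x')"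
    by (rule roots_G2_act[OF r B c q])
  have "B$1$1 * B$2$2 - B$1$2 * B$2$1 \<noteq> 0" using B by (simp add: invertible_det_nz det_2)
  with r rq show ?thesis
    unfolding has_arrangement_iff[OF r] has_arrangement_iff[OF rq]
    by (elim rootsE) (simp add: arrangement_adjugate)
qed

text \<open>The interface for normalising roots: a real matrix with rows \<open>(r, s)\<close> and
  \<open>(t, w)\<close> is chosen so that its adjugate sends the roots to multiples of prescribed
  coordinates. In applications, the way the determinant is written selects the matrix by
  unification.\<close>

lemma roots_move:
  fixes r s t w :: real
  assumes "roots p x y x' y'" "r * w - s * t \<noteq> 0"
    and "of_real w * x - of_real s * y = c * u" "of_real r * y - of_real t * x = c * v"
    and "of_real w * x' - of_real s * y' = c' * u'" "of_real r * y' - of_real t * x' = c' * v'"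
  obtains q where "(p, q) \<in> G2_equiv" "roots q u v u' v'"
    "arrangement (pt u v) (pt u' v') = arrangement (pt x y) (pt x' y')"
proof -
  define A :: "real^2^2" where "A = vector [vector [r, s], vector [t, w]]"
  have A: "invertible A" using assms(2) by (simp add: A_def invertible_det_nz det_2)
  define q where "q = Cst 1 * G2_act (A, 0) p"
  note q = roots_G2_act[OF assms(1) A one_neq_zero q_def]
  have r: "roots q u v u' v'"
    by (rule roots_scale[OF q(1), of c u v c' u' v']) (use assms in \<open>simp_all add: A_def\<close>)
  have "arrangement (pt u v) (pt u' v') = arrangement (pt x y) (pt x' y')"
    using has_arrangement_equiv[OF q(2)] has_arrangement_iff[OF r] has_arrangement_iff[OF assms(1)] by simp
  with q r show ?thesis using that by blast
qed

lemma G2_equiv_trans: "(p, q) \<in> G2_equiv \<Longrightarrow> (q, r) \<in> G2_equiv \<Longrightarrow> (p, r) \<in> G2_equiv"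
  and G2_equiv_sym: "(p, q) \<in> G2_equiv \<Longrightarrow> (q, p) \<in> G2_equiv"
  using equiv_G2_equiv by (meson equivE symD transD)+

section \<open>Translations and completing the square\<close>

lemma invertible_mat_1: "invertible (mat 1 :: real^2^2)"
  by (simp add: invertible_det_nz)

text \<open>After translation by \<open>(s, t)\<close> the linear coefficients are the partial
  derivatives at that point and the constant is the value there; everything is then divided by
  \<open>k\<close>.\<close>

lemma translate_scale_equiv:
  assumes "a \<noteq> 0 \<or> b \<noteq> 0 \<or> c \<noteq> 0" "k \<noteq> 0"
  shows "(conic_of (k * a) (k * b) (k * c) d e f, 
    conic_of a b c ((2 * (k * a) * s + k * b * t + d) / k) ((k * b * s + 2 * (k * c) * t + e) / k)
      ((k * a * s\<^sup>2 + k * b * s * t + k * c * t\<^sup>2 + d * s + e * t + f) / k)) \<in> G2_equiv"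
proof (rule G2_equivI[where A = "mat 1" and b = "vector [s, t]" and c = "1 / k", OF _ _ invertible_mat_1])
  show "conic_of a b c ((2 * (k * a) * s + k * b * t + d) / k) ((k * b * s + 2 * (k * c) * t + e) / k)
      ((k * a * s\<^sup>2 + k * b * s * t + k * c * t\<^sup>2 + d * s + e * t + f) / k)
    = Cst (1 / k) * G2_act (mat 1, vector [s, t]) (conic_of (k * a) (k * b) (k * c) d e f)"
    unfolding G2_act.simps subst2_conic Cst_mult_conic conic_eq_iff
    using assms(2) by (simp add: mat_def)
qed (use assms in \<open>auto simp: conic_mem_conics\<close>)

text \<open>A nonzero discriminant gives the conic a centre, the point where both partial
  derivatives vanish; translating it to the origin removes the linear part.\<close>

lemma central_equiv:
  assumes "p \<in> conics" "initial_form p = Cst k * conic_of a b c 0 0 0" "4 * a * c \<noteq> b\<^sup>2"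
  obtains \<gamma> where "(p, conic_of a b c 0 0 \<gamma>) \<in> G2_equiv"
proof -
  from assms(1) obtain a' b' c' d e f where p: "p = conic_of a' b' c' d e f" "a' \<noteq> 0 \<or> b' \<noteq> 0 \<or> c' \<noteq> 0"
    by (rule conicsE)
  then have abc: "a' = k * a" "b' = k * b" "c' = k * c" and k: "k \<noteq> 0"
    using assms(2) by (auto simp: initial_form_conic_coeffs Cst_mult_conic conic_eq_iff)
  \<comment> \<open>Cramer's rule for the two derivative equations, with one factor \<open>k\<close>
    cancelled.\<close>
  define D where "D = k * (4 * a * c - b\<^sup>2)"
  have D: "D \<noteq> 0" using assms(3) k by (simp add: D_def)
  define s where "s = (b * e - 2 * c * d) / D"
  define t where "t = (b * d - 2 * a * e) / D"
  have "D * (2 * (k * a) * s + k * b * t + d) = 0" "D * (k * b * s + 2 * (k * c) * t + e) = 0"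
    using D unfolding s_def t_def by (simp_all add: distrib_left) (simp_all add: D_def algebra_simps power2_eq_square)
  then have "2 * (k * a) * s + k * b * t + d = 0" "k * b * s + 2 * (k * c) * t + e = 0"
    using D by simp_all
  moreover have "a \<noteq> 0 \<or> b \<noteq> 0 \<or> c \<noteq> 0" using assms(3) by auto
  ultimately show ?thesis
    using translate_scale_equiv[of a b c k d e f s t] k that by (simp add: p abc)
qed

text \<open>The quadratic part is a multiple of the square of z1 - \<beta> z2, constant along the
  direction (\<beta>, 1). On this direction the linear part takes the value \<beta> d + e: if it
  vanishes, the square can be completed without linear remainder; otherwise moving along the
  direction removes the constant.\<close>

lemma double_equiv:
  assumes "roots p \<beta> 1 \<beta> 1"
  obtains \<gamma> where "(p, conic_of 1 (-2 * \<beta>) (\<beta>\<^sup>2) 0 0 \<gamma>) \<in> G2_equiv"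
  | \<gamma> where "\<gamma> \<noteq> 0" "(p, conic_of 1 (-2 * \<beta>) (\<beta>\<^sup>2) 0 \<gamma> 0) \<in> G2_equiv"
proof -
  obtain k where k: "k \<noteq> 0" and i: "initial_form p = Cst k * (lform \<beta> 1 * lform \<beta> 1)"
    using assms by (rule rootsE)
  have "p \<in> conics" using assms by (simp add: roots_def)
  then obtain a' b' c' d e f where p: "p = conic_of a' b' c' d e f" by (rule conicsE)
  have abc: "a' = k * 1" "b' = k * (-2 * \<beta>)" "c' = k * \<beta>\<^sup>2"
    using i by (auto simp: p initial_form_conic_coeffs Cst_mult_conic lform_mult conic_eq_iff power2_eq_square)
  \<comment> \<open>This translation in z1 cancels the coefficient of z1.\<close>
  define s where "s = - d / (2 * k)"
  show ?thesis
  proof (cases "\<beta> * d + e = 0")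
    case True
    have e: "e = - (\<beta> * d)" using True by algebra
    have "(2 * (k * 1) * s + k * (-2 * \<beta>) * 0 + d) / k = 0" "(k * (-2 * \<beta>) * s + 2 * (k * \<beta>\<^sup>2) * 0 + e) / k = 0"
      using k by (simp_all add: s_def e)
    with translate_scale_equiv[of 1 "-2 * \<beta>" "\<beta>\<^sup>2" k d e f s 0] k that(1) show ?thesis
      unfolding p abc by simp
  next
    case False
    define g where "g = \<beta> * d + e"
    have g: "g \<noteq> 0" using False by (simp add: g_def)
    have e: "e = g - \<beta> * d" by (simp add: g_def)
    \<comment> \<open>Moving by t (\<beta>, 1) keeps the derivatives and adds t g to the value, so t
      is chosen to cancel the constant left by completing the square.\<close>
    define t where "t = (d\<^sup>2 / (4 * k) - f) / g"
    have tg: "t * g = d\<^sup>2 / (4 * k) - f" using g by (simp add: t_def)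
    have ks: "k * s\<^sup>2 + d * s = - d\<^sup>2 / (4 * k)"
      using k by (simp add: s_def field_simps power2_eq_square)
    have 1: "(2 * (k * 1) * (s + \<beta> * t) + k * (-2 * \<beta>) * t + d) / k = 0"
      and 2: "(k * (-2 * \<beta>) * (s + \<beta> * t) + 2 * (k * \<beta>\<^sup>2) * t + e) / k = g / k"
      using k by (simp_all add: s_def e algebra_simps power2_eq_square)
    have "k * 1 * (s + \<beta> * t)\<^sup>2 + k * (-2 * \<beta>) * (s + \<beta> * t) * t + k * \<beta>\<^sup>2 * t\<^sup>2 + d * (s + \<beta> * t) + e * t + f
      = k * s\<^sup>2 + d * s + t * g + f"
      by (simp add: e algebra_simps power2_eq_square)
    also have "\<dots> = 0" by (simp add: ks tg)
    finally show ?thesis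
      using translate_scale_equiv[of 1 "-2 * \<beta>" "\<beta>\<^sup>2" k d e f "s + \<beta> * t" t] k that(2)[of "g / k"] g
      unfolding p abc 1 2 by simp
  qed
qed

section \<open>Arrangements of the representatives\<close>

lemma representatives_conic:
  "Z1\<^sup>2 + Cst \<gamma> = conic_of 1 0 0 0 0 \<gamma>"
  "Z1\<^sup>2 + Cst \<gamma> * Z2 = conic_of 1 0 0 0 \<gamma> 0"
  "Z1 * Z2 + Cst \<gamma> = conic_of 0 1 0 0 0 \<gamma>"
  "(Z1 - Cst \<i> * Z2)\<^sup>2 + Cst \<gamma> = conic_of 1 (-2 * \<i>) (-1) 0 0 \<gamma>"
  "(Z1 - Cst \<i> * Z2)\<^sup>2 + Cst \<gamma> * Z2 = conic_of 1 (-2 * \<i>) (-1) 0 \<gamma> 0"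
  "Z2 * (Z1 - Cst \<alpha> * Z2) + Cst \<gamma> = conic_of 0 1 (- \<alpha>) 0 0 \<gamma>"
  "Z1\<^sup>2 + Z2\<^sup>2 + Cst \<gamma> = conic_of 1 0 1 0 0 \<gamma>"
  "(Z1 - Cst \<i> * Z2) * (Z1 - Cst \<alpha> * Z2) + Cst \<gamma> = conic_of 1 (- (\<i> + \<alpha>)) (\<i> * \<alpha>) 0 0 \<gamma>"
  by (simp_all add: conic_of_def Cst_def Z1_def Z2_def power2_eq_square)

lemmas lform_initial = initial_form_conic_coeffs lform_mult Cst_mult_conic conic_eq_iff

lemma representatives_subset: "representatives F \<subseteq> conics"
  by (cases F) (auto simp: representatives_conic conic_mem_conics)

lemma representatives_has_arrangement:
  assumes "q \<in> representatives F"
  shows "has_arrangement (initial_form q) (family_arrangement F)"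
proof -
  have "q \<in> conics" using assms representatives_subset by blast
  have *: ?thesis if "roots q x y x' y'" "arrangement (pt x y) (pt x' y') = family_arrangement F" for x y x' y'
    using has_arrangement_iff[OF that(1)] that(2) by simp
  have r: "roots q x y x' y'" if "initial_form q = Cst k * (lform x y * lform x' y')" for k x y x' y'
    using that \<open>q \<in> conics\<close> by (auto simp: roots_def)
  show ?thesis
  proof (cases F)
    case Fam_1a1
    with assms have "initial_form q = Cst 1 * (lform 0 1 * lform 0 1)"
      by (auto simp: representatives_conic lform_initial)
    then show ?thesis using Fam_1a1 by (intro *[OF r]) (auto simp: arrangement_def real_point_pt pt_eq_iff)
  next
    case Fam_1a2
    with assms have "initial_form q = Cst 1 * (lform 0 1 * lform 0 1)"
      by (auto simp: representatives_conic lform_initial)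
    then show ?thesis using Fam_1a2 by (intro *[OF r]) (auto simp: arrangement_def real_point_pt pt_eq_iff)
  next
    case Fam_1b
    with assms have "initial_form q = Cst (-1) * (lform 1 0 * lform 0 1)"
      by (auto simp: representatives_conic lform_initial)
    then show ?thesis using Fam_1b by (intro *[OF r]) (auto simp: arrangement_def real_point_pt pt_eq_iff)
  next
    case Fam_2a1
    with assms have "initial_form q = Cst 1 * (lform \<i> 1 * lform \<i> 1)"
      by (auto simp: representatives_conic lform_initial)
    then show ?thesis using Fam_2a1 by (intro *[OF r]) (auto simp: arrangement_def real_point_pt pt_eq_iff)
  next
    case Fam_2a2
    with assms have "initial_form q = Cst 1 * (lform \<i> 1 * lform \<i> 1)"
      by (auto simp: representatives_conic lform_initial)
    then show ?thesis using Fam_2a2 by (intro *[OF r]) (auto simp: arrangement_def real_point_pt pt_eq_iff)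
  next
    case Fam_2b
    with assms obtain \<alpha> where "initial_form q = Cst (-1) * (lform 1 0 * lform \<alpha> 1)" "\<alpha> \<notin> \<real>"
      by (auto simp: representatives_conic lform_initial)
    then show ?thesis using Fam_2b
      by (intro *[OF r]) (auto simp: arrangement_def real_point_pt pt_eq_iff complex_is_Real_iff)
  next
    case Fam_2c1
    with assms have "initial_form q = Cst 1 * (lform \<i> 1 * lform (-\<i>) 1)"
      by (auto simp: representatives_conic lform_initial)
    then show ?thesis using Fam_2c1 by (intro *[OF r]) (auto simp: arrangement_def real_point_pt pt_eq_iff)
  next
    case Fam_2c2
    with assms obtain \<alpha> where "initial_form q = Cst 1 * (lform \<i> 1 * lform \<alpha> 1)" "\<alpha> \<notin> \<real>" "\<alpha> \<noteq> \<i>"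
      by (auto simp: representatives_conic lform_initial)
    then show ?thesis using Fam_2c2
      by (intro *[OF r]) (auto simp: arrangement_def real_point_pt pt_eq_iff complex_is_Real_iff)
  qed
qed

section \<open>Existence of a representative\<close>

text \<open>Real coordinates of a real point are extracted because they serve as entries of the
  normalising matrices.\<close>

lemma real_point_multiple:
  assumes "Im (x * cnj y) = 0" "x \<noteq> 0 \<or> y \<noteq> 0"
  obtains c and r s :: real where "x = c * of_real r" "y = c * of_real s" "r \<noteq> 0 \<or> s \<noteq> 0"
proof (cases "y = 0")
  case True
  with assms that[of x 1 0] show ?thesis by simp
next
  case False
  with assms(1) have "x / y = of_real (Re (x / y))"
    by (simp add: complex_eq_iff Im_complex_div_eq_0)
  with False that[of y "Re (x / y)" 1] show ?thesis by (simp add: field_simps)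
qed

lemma double_representative:
  assumes "roots p x y x y"
  obtains F q where "q \<in> representatives F" "(p, q) \<in> G2_equiv"
proof -
  have nz: "x \<noteq> 0 \<or> y \<noteq> 0" using assms by (rule rootsE)
  show ?thesis
  proof (cases "Im (x * cnj y) = 0")
    case True
    obtain c and r s :: real where c: "x = c * of_real r" "y = c * of_real s" "r \<noteq> 0 \<or> s \<noteq> 0"
      using real_point_multiple[OF True nz] by metis
    have "r\<^sup>2 + s\<^sup>2 \<noteq> 0" using c(3) by (simp add: sum_power2_eq_zero_iff)
    \<comment> \<open>The matrix with rows \<open>(s, r)\<close> and \<open>(- r, s)\<close>, a
      rotation up to scale, whose adjugate sends (r:s) to (0:1).\<close>
    then have det: "s * s - r * (- r) \<noteq> 0" by (simp add: power2_eq_square add.commute)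
    obtain q where q: "(p, q) \<in> G2_equiv" "roots q 0 1 0 1"
      by (rule roots_move[OF assms det,
            where c = "c * (r\<^sup>2 + s\<^sup>2)" and c' = "c * (r\<^sup>2 + s\<^sup>2)"
              and u = 0 and v = 1 and u' = 0 and v' = 1])
        (simp_all add: c algebra_simps power2_eq_square)
    from q(2) show ?thesis
    proof (cases rule: double_equiv)
      case (1 \<gamma>)
      have "(p, Z1\<^sup>2 + Cst \<gamma>) \<in> G2_equiv"
        using G2_equiv_trans[OF q(1)] 1 by (simp add: representatives_conic)
      then show ?thesis by (rule that[of _ Fam_1a1, rotated]) auto
    next
      case (2 \<gamma>)
      have "(p, Z1\<^sup>2 + Cst \<gamma> * Z2) \<in> G2_equiv"
        using G2_equiv_trans[OF q(1)] 2 by (simp add: representatives_conic)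
      then show ?thesis by (rule that[of _ Fam_1a2, rotated]) (use 2 in auto)
    qed
  next
    case False
    \<comment> \<open>The matrix with rows \<open>(Im x, Re x)\<close> and
      \<open>(Im y, Re y)\<close> sends (i, 1) to (x, y), so its adjugate sends (x, y) to a multiple
      of (i, 1).\<close>
    then have det: "Im x * Re y - Re x * Im y \<noteq> 0" by (simp add: algebra_simps)
    define D where "D = complex_of_real (Im x * Re y - Re x * Im y)"
    have e: "of_real (Re y) * x - of_real (Re x) * y = D * \<i>" "of_real (Im x) * y - of_real (Im y) * x = D * 1"
      by (simp_all add: D_def complex_eq_iff algebra_simps)
    obtain q where q: "(p, q) \<in> G2_equiv" "roots q \<i> 1 \<i> 1"
      by (rule roots_move[OF assms det e e])
    from q(2) show ?thesis
    proof (cases rule: double_equiv)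
      case (1 \<gamma>)
      have "(p, (Z1 - Cst \<i> * Z2)\<^sup>2 + Cst \<gamma>) \<in> G2_equiv"
        using G2_equiv_trans[OF q(1)] 1 by (simp add: representatives_conic)
      then show ?thesis by (rule that[of _ Fam_2a1, rotated]) auto
    next
      case (2 \<gamma>)
      have "(p, (Z1 - Cst \<i> * Z2)\<^sup>2 + Cst \<gamma> * Z2) \<in> G2_equiv"
        using G2_equiv_trans[OF q(1)] 2 by (simp add: representatives_conic)
      then show ?thesis by (rule that[of _ Fam_2a2, rotated]) (use 2 in auto)
    qed
  qed
qed

lemma real_root_representative:
  assumes p: "roots p x y x' y'" and ne: "x * y' \<noteq> y * x'" and real: "Im (x * cnj y) = 0"
  obtains F q where "q \<in> representatives F" "(p, q) \<in> G2_equiv"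
proof -
  have nz: "x \<noteq> 0 \<or> y \<noteq> 0" "x' \<noteq> 0 \<or> y' \<noteq> 0" using ne by auto
  obtain c and r s :: real where c: "x = c * of_real r" "y = c * of_real s" "r \<noteq> 0 \<or> s \<noteq> 0"
    using real_point_multiple[OF real nz(1)] by metis
  show ?thesis
  proof (cases "Im (x' * cnj y') = 0")
    case True
    obtain c' and r' s' :: real where c': "x' = c' * of_real r'" "y' = c' * of_real s'"
      using real_point_multiple[OF True nz(2)] by metis
    \<comment> \<open>The columns of the matrix are the two real roots, which the adjugate sends to
      (1:0) and (0:1).\<close>
    have det: "r * s' - r' * s \<noteq> 0"
    proof
      assume "r * s' - r' * s = 0"
      then have "complex_of_real r * of_real s' - of_real r' * of_real s = 0"
        by (metis of_real_0 of_real_diff of_real_mult)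
      then have "x * y' - y * x' = 0" unfolding c c' by algebra
      with ne show False by simp
    qed
    obtain q where q: "(p, q) \<in> G2_equiv" "roots q 1 0 0 1"
      by (rule roots_move[OF p det,
            where c = "c * (r * s' - r' * s)" and c' = "c' * (r * s' - r' * s)"
              and u = 1 and v = 0 and u' = 0 and v' = 1])
        (simp_all add: c c' algebra_simps)
    obtain k where k: "initial_form q = Cst k * (lform 1 0 * lform 0 1)" using q(2) by (rule rootsE)
    have "initial_form q = Cst (-k) * conic_of 0 1 0 0 0 0" unfolding k lform_mult Cst_mult_conic by simp
    then obtain \<gamma> where \<gamma>: "(q, conic_of 0 1 0 0 0 \<gamma>) \<in> G2_equiv"
      using q(2) central_equiv[of q "-k" 0 1 0] by (auto simp: roots_def)
    have "(p, Z1 * Z2 + Cst \<gamma>) \<in> G2_equiv"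
      using G2_equiv_trans[OF q(1) \<gamma>] by (simp add: representatives_conic)
    then show ?thesis by (rule that[of _ Fam_1b, rotated]) auto
  next
    case False
    have "r\<^sup>2 + s\<^sup>2 \<noteq> 0" using c(3) by (simp add: sum_power2_eq_zero_iff)
    \<comment> \<open>A rotation up to scale that sends (1:0) to the real root (r:s).\<close>
    then have det: "r * r - (- s) * s \<noteq> 0" by (simp add: power2_eq_square)
    \<comment> \<open>The second coordinate of the image of the other root; it is nonzero because
      the roots differ, so that image can be written as (\<alpha>:1).\<close>
    define c' where "c' = of_real r * y' - of_real s * x'"
    have c'nz: "c' \<noteq> 0"
    proof
      assume "c' = 0"
      then have "x * y' - y * x' = 0" unfolding c c'_def by algebra
      with ne show False by simp
    qed
    define \<alpha> where "\<alpha> = (of_real r * x' + of_real s * y') / c'"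
    obtain q where q: "(p, q) \<in> G2_equiv" "roots q 1 0 \<alpha> 1"
      and arr: "arrangement (pt 1 0) (pt \<alpha> 1) = arrangement (pt x y) (pt x' y')"
      by (rule roots_move[OF p det,
            where c = "c * (r\<^sup>2 + s\<^sup>2)" and c' = c'
              and u = 1 and v = 0 and u' = \<alpha> and v' = 1])
        (use c'nz in \<open>simp_all add: c \<alpha>_def algebra_simps power2_eq_square, simp_all add: c'_def\<close>)
    \<comment> \<open>The arrangement is preserved, and (1:0) is already real.\<close>
    have "\<alpha> \<notin> \<real>"
      using arr real False ne nz
      by (auto simp: arrangement_def real_point_pt pt_eq_iff complex_is_Real_iff split: if_splits)
    obtain k where k: "initial_form q = Cst k * (lform 1 0 * lform \<alpha> 1)" using q(2) by (rule rootsE)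
    have "initial_form q = Cst (-k) * conic_of 0 1 (-\<alpha>) 0 0 0" unfolding k lform_mult Cst_mult_conic by simp
    then obtain \<gamma> where \<gamma>: "(q, conic_of 0 1 (-\<alpha>) 0 0 \<gamma>) \<in> G2_equiv"
      using q(2) central_equiv[of q "-k" 0 1 "-\<alpha>"] by (auto simp: roots_def)
    have "(p, Z2 * (Z1 - Cst \<alpha> * Z2) + Cst \<gamma>) \<in> G2_equiv"
      using G2_equiv_trans[OF q(1) \<gamma>] by (simp add: representatives_conic)
    then show ?thesis by (rule that[of _ Fam_2b, rotated]) (use \<open>\<alpha> \<notin> \<real>\<close> in auto)
  qed
qed

lemma nonreal_roots_representative:
  assumes p: "roots p x y x' y'" and ne: "x * y' \<noteq> y * x'"
    and nonreal: "Im (x * cnj y) \<noteq> 0" "Im (x' * cnj y') \<noteq> 0"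
  obtains F q where "q \<in> representatives F" "(p, q) \<in> G2_equiv"
proof -
  have nz: "x \<noteq> 0 \<or> y \<noteq> 0" "x' \<noteq> 0 \<or> y' \<noteq> 0" using ne by auto
  \<comment> \<open>As for a double non-real root, the matrix sends (i, 1) to (x, y); it is used
    here to normalise the first root only.\<close>
  have det: "Im x * Re y - Re x * Im y \<noteq> 0" using nonreal(1) by (simp add: algebra_simps)
  define D where "D = complex_of_real (Im x * Re y - Re x * Im y)"
  have e: "of_real (Re y) * x - of_real (Re x) * y = D * \<i>" "of_real (Im x) * y - of_real (Im y) * x = D * 1"
    by (simp_all add: D_def complex_eq_iff algebra_simps)
  define c' where "c' = of_real (Im x) * y' - of_real (Im y) * x'"
  \<comment> \<open>Otherwise (x':y') would be the real point (\<open>Im x\<close> :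
    \<open>Im y\<close>).\<close>
  have c'nz: "c' \<noteq> 0"
  proof
    assume "c' = 0"
    then have "Im x * Re y' = Im y * Re x'" "Im x * Im y' = Im y * Im x'"
      by (simp_all add: c'_def complex_eq_iff)
    then have "Im x * Im (x' * cnj y') = 0" "Im y * Im (x' * cnj y') = 0"
      by (simp_all, algebra+)
    with nonreal(2) have "Im x = 0" "Im y = 0" by simp_all
    with det show False by simp
  qed
  define \<alpha> where "\<alpha> = (of_real (Re y) * x' - of_real (Re x) * y') / c'"
  obtain q where q: "(p, q) \<in> G2_equiv" "roots q \<i> 1 \<alpha> 1"
    and arr: "arrangement (pt \<i> 1) (pt \<alpha> 1) = arrangement (pt x y) (pt x' y')"
    by (rule roots_move[OF p det e, where c' = c' and u' = \<alpha> and v' = 1])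
      (use c'nz in \<open>simp_all add: \<alpha>_def, simp_all add: c'_def\<close>)
  have \<alpha>: "\<alpha> \<notin> \<real>" "\<alpha> \<noteq> \<i>"
    using arr nonreal ne nz
    by (auto simp: arrangement_def real_point_pt pt_eq_iff complex_is_Real_iff split: if_splits)
  obtain k where k: "initial_form q = Cst k * (lform \<i> 1 * lform \<alpha> 1)" using q(2) by (rule rootsE)
  have "initial_form q = Cst k * conic_of 1 (- (\<i> + \<alpha>)) (\<i> * \<alpha>) 0 0 0" unfolding k lform_mult by simp
  \<comment> \<open>The two sides differ by the square of \<alpha> - i, so distinct roots give a
    nonzero discriminant.\<close>
  moreover have "4 * 1 * (\<i> * \<alpha>) \<noteq> (- (\<i> + \<alpha>))\<^sup>2"
  proof
    assume "4 * 1 * (\<i> * \<alpha>) = (- (\<i> + \<alpha>))\<^sup>2"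
    then have "(\<alpha> - \<i>)\<^sup>2 = 0" by algebra
    with \<alpha>(2) show False by simp
  qed
  moreover have "q \<in> conics" using q(2) by (simp add: roots_def)
  ultimately obtain \<gamma> where \<gamma>: "(q, conic_of 1 (- (\<i> + \<alpha>)) (\<i> * \<alpha>) 0 0 \<gamma>) \<in> G2_equiv"
    using central_equiv by blast
  show ?thesis
  proof (cases "\<alpha> = - \<i>")
    case True
    have "(p, Z1\<^sup>2 + Z2\<^sup>2 + Cst \<gamma>) \<in> G2_equiv"
      using G2_equiv_trans[OF q(1) \<gamma>] True by (simp add: representatives_conic)
    then show ?thesis by (rule that[of _ Fam_2c1, rotated]) auto
  next
    case False
    have "(p, (Z1 - Cst \<i> * Z2) * (Z1 - Cst \<alpha> * Z2) + Cst \<gamma>) \<in> G2_equiv"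
      using q(1) \<gamma> G2_equiv_trans unfolding representatives_conic by blast
    then show ?thesis by (rule that[of _ Fam_2c2, rotated]) (use \<alpha> False in auto)
  qed
qed

lemma representative_exists:
  assumes "p \<in> conics"
  obtains F q where "q \<in> representatives F" "(p, q) \<in> G2_equiv"
proof -
  obtain x y x' y' where r: "roots p x y x' y'" using roots_exist[OF assms] .
  have nz: "x \<noteq> 0 \<or> y \<noteq> 0" "x' \<noteq> 0 \<or> y' \<noteq> 0" using r by (auto elim: rootsE)
  consider "x * y' = y * x'" | "x * y' \<noteq> y * x'" "Im (x * cnj y) = 0"
    | "x * y' \<noteq> y * x'" "Im (x' * cnj y') = 0"
    | "x * y' \<noteq> y * x'" "Im (x * cnj y) \<noteq> 0" "Im (x' * cnj y') \<noteq> 0" by blast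
  then show ?thesis
  proof cases
    case 1
    obtain k where k: "x' = k * x" "y' = k * y" using proportional_coords[OF nz(1) 1] .
    have "roots p x y x y" by (rule roots_scale[OF r, of 1 _ _ k]) (simp_all add: k)
    then show ?thesis using double_representative that by blast
  next
    case 2
    with r show ?thesis using real_root_representative that by blast
  next
    case 3
    moreover from 3 have "x' * y \<noteq> y' * x" by (auto simp: mult.commute)
    ultimately show ?thesis using real_root_representative[OF roots_commute[OF r]] that by blast
  next
    case 4
    with r show ?thesis using nonreal_roots_representative that by blast
  qed
qed

section \<open>Separation of the families\<close>

text \<open>A real substitution into the real form z1^2 + z2^2 gives a scalar times a real form.
  With leading coefficient 1 the scalar is real, so i + \<alpha> and i \<alpha> are both real, which
  forces \<alpha> = -i.\<close>

lemma not_equiv_2c: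
  assumes "\<alpha> \<noteq> - \<i>"
  shows "(conic_of 1 0 1 0 0 \<gamma>, conic_of 1 (- (\<i> + \<alpha>)) (\<i> * \<alpha>) 0 0 \<delta>) \<notin> G2_equiv"
proof
  assume "(conic_of 1 0 1 0 0 \<gamma>, conic_of 1 (- (\<i> + \<alpha>)) (\<i> * \<alpha>) 0 0 \<delta>) \<in> G2_equiv"
  then obtain A b k where q: "conic_of 1 (- (\<i> + \<alpha>)) (\<i> * \<alpha>) 0 0 \<delta> = Cst k * G2_act (A, b) (conic_of 1 0 1 0 0 \<gamma>)"
    by (rule G2_equivE)
  let ?n = "(A$1$1)\<^sup>2 + (A$2$1)\<^sup>2"
  have e: "1 = k * ?n" "- (\<i> + \<alpha>) = k * of_real (2 * (A$1$1 * A$1$2 + A$2$1 * A$2$2))"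
    "\<i> * \<alpha> = k * of_real ((A$1$2)\<^sup>2 + (A$2$2)\<^sup>2)"
    using q unfolding G2_act.simps subst2_conic Cst_mult_conic conic_eq_iff
    by (simp_all add: algebra_simps)
  have "k = of_real (1 / ?n)"
    using e(1) by (metis mult_eq_0_iff nonzero_eq_divide_eq of_real_1 of_real_divide of_real_eq_0_iff zero_neq_one)
  then have "- (\<i> + \<alpha>) \<in> \<real>" "\<i> * \<alpha> \<in> \<real>" unfolding e by (metis Reals_mult Reals_of_real)+
  then have "\<alpha> = - \<i>" by (simp add: complex_is_Real_iff complex_eq_iff)
  with assms show False ..
qed

text \<open>The arrangement leaves only the pairs inside (1a), (2a) and (2c). In the first two,
  \<open>disc3\<close> vanishes for the representatives with constant \<gamma> and equals minus the
  square of \<gamma> for those with \<gamma> z2.\<close>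

lemma family_unique:
  assumes "q \<in> representatives F" "q' \<in> representatives F'" "(q, q') \<in> G2_equiv"
  shows "F = F'"
proof -
  have "q \<in> conics" using assms(1) representatives_subset by blast
  then obtain x y x' y' where r: "roots q x y x' y'" by (rule roots_exist)
  have "has_arrangement (initial_form q) (family_arrangement F)"
    "has_arrangement (initial_form q) (family_arrangement F')"
    using assms representatives_has_arrangement has_arrangement_equiv by blast+
  then have arr: "family_arrangement F = family_arrangement F'"
    using has_arrangement_iff[OF r] by simp
  \<comment> \<open>The pair (2c.1), (2c.2) occurs in both orders, while \<open>not_equiv_2c\<close>
    starts from (2c.1).\<close>
  have sym: "(q', q) \<in> G2_equiv" using assms(3) by (rule G2_equiv_sym)
  have "disc3 q = 0 \<longleftrightarrow> disc3 q' = 0" using assms(3) by (rule disc3_equiv)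
  then show ?thesis
    using arr assms sym
    by (cases F; cases F') (auto simp: representatives_conic disc3_conic not_equiv_2c[simplified])
qed

section \<open>Infinitely many orbits\<close>

lemma infinite_orbits: "infinite (conics // G2_equiv)"
proof
  assume fin: "finite (conics // G2_equiv)"
  \<comment> \<open>All constants have imaginary part 1, so a real factor relating two of them must
    be 1.\<close>
  define f :: "nat \<Rightarrow> cpoly2" where "f n = conic_of 1 0 0 0 0 (of_nat n + \<i>)" for n
  have "m = n" if "G2_equiv `` {f m} = G2_equiv `` {f n}" for m n
  proof -
    have "f n \<in> conics" by (simp add: f_def conic_mem_conics)
    with that have "(f m, f n) \<in> G2_equiv" by (metis equiv_G2_equiv eq_equiv_class)
    then obtain A b k where q: "f n = Cst k * G2_act (A, b) (f m)"
      by (rule G2_equivE)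
    have e: "1 = k * (of_real (A$1$1))\<^sup>2" "0 = k * of_real (A$1$1) * b$1"
      "of_nat n + \<i> = k * (b$1)\<^sup>2 + k * (of_nat m + \<i>)"
      using q unfolding f_def G2_act.simps subst2_conic Cst_mult_conic conic_eq_iff
      by (simp_all add: algebra_simps)
    \<comment> \<open>Both \<open>k\<close> and \<open>A$1$1\<close> are nonzero by the leading
      coefficient, and neither conic has a z1 term.\<close>
    have "b$1 = 0" using e(1,2) by auto
    then have *: "of_nat n + \<i> = k * (of_nat m + \<i>)" using e(3) by simp
    have "k = of_real (1 / (A$1$1)\<^sup>2)" using e(1) by (metis mult_zero_right nonzero_eq_divide_eq of_real_1 of_real_divide of_real_power zero_neq_one)
    then obtain l where l: "k = of_real l" by blast
    with * have "l = 1" by (simp add: complex_eq_iff)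
    with * l show "m = n" by simp
  qed
  then have "inj (\<lambda>n. G2_equiv `` {f n})" by (auto intro: injI)
  moreover have "range (\<lambda>n. G2_equiv `` {f n}) \<subseteq> conics // G2_equiv"
    by (auto simp: f_def conic_mem_conics intro!: quotientI)
  ultimately show False using fin by (meson finite_subset finite_imageD infinite_UNIV_nat)
qed

theorem theorem5p5:
  shows "infinite (conics // G2_equiv) \<and>
    (\<forall>F. representatives F \<subseteq> conics) \<and>
    (\<forall>p\<in>conics. \<exists>!F. \<exists>q\<in>representatives F. (p, q) \<in> G2_equiv) \<and>
    (\<forall>p\<in>conics. \<forall>A. has_arrangement (initial_form p) A \<longleftrightarrow>
      (\<exists>F. family_arrangement F = A \<and> (\<exists>q\<in>representatives F. (p, q) \<in> G2_equiv)))"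
proof (intro conjI ballI allI)
  show "infinite (conics // G2_equiv)" by (rule infinite_orbits)
  show "representatives F \<subseteq> conics" for F by (rule representatives_subset)
next
  fix p assume p: "p \<in> conics"
  show "\<exists>!F. \<exists>q\<in>representatives F. (p, q) \<in> G2_equiv"
  proof (rule ex_ex1I)
    show "\<exists>F. \<exists>q\<in>representatives F. (p, q) \<in> G2_equiv"
      using representative_exists[OF p] by metis
  next
    fix F F'
    assume "\<exists>q\<in>representatives F. (p, q) \<in> G2_equiv" "\<exists>q\<in>representatives F'. (p, q) \<in> G2_equiv"
    then show "F = F'" by (meson family_unique G2_equiv_sym G2_equiv_trans)
  qed
  fix A
  obtain x y x' y' where r: "roots p x y x' y'" using roots_exist[OF p] .
  obtain F q where F: "q \<in> representatives F" "(p, q) \<in> G2_equiv" using representative_exists[OF p] .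
  have arr: "has_arrangement (initial_form p) (family_arrangement F)"
    if "q \<in> representatives F" "(p, q) \<in> G2_equiv" for F q
    using that representatives_has_arrangement has_arrangement_equiv by blast
  \<comment> \<open>By \<open>arr\<close>, any family that meets the orbit has an arrangement of p,
    and p has only one.\<close>
  show "has_arrangement (initial_form p) A \<longleftrightarrow>
      (\<exists>F. family_arrangement F = A \<and> (\<exists>q\<in>representatives F. (p, q) \<in> G2_equiv))"
    using arr F has_arrangement_iff[OF r] by metis
qed

end
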